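(* Let $R$ be a principal ideal domain and let $I=gR\subsetneq R$ be a proper, non-prime ideal such that $Q:=R/I$ is finite. Suppose that $g=u\cdot p_1p_2$ with $u$ a unit and $p_1,p_2$ non-associated prime elements. Then $\Gamma_{E'}(Q)$ is a clique, and in particular $\mathrm{box}(\Gamma_{E'}(Q))=0$.
   Context: Rings are commutative and non-zero with $1$. For a ring $Q$, $Z(Q)$ is the set of $r\in Q$ for which there is $s\in Q\setminus\{0\}$ with $rs=0$. The zero divisor graph $\Gamma(Q)$ has vertex set $Z(Q)\setminus\{0\}$; two distinct vertices $r,s$ are adjacent iff $rs=0$. For a graph $G=(V,E)$ with neighbourhoods $N(\cdot)$, define $u\sim' v$ if $N(u)\setminus\{u,v\}=N(v)\setminus\{u,v\}$; this is an equivalence relation, with classes $[v]'$. The graph $G_{E'}$ has vertex set $\{[v]'\colon v\in V\}$ and edge set $\{\{[u]',[v]'\}\colon [u]'\ne[v]' \text{ and } \{u,v\}\in E\}$. $\Gamma_{E'}(Q)$ denotes $G_{E'}$ for $G=\Gamma(Q)$. A clique is a complete graph (a single vertex counts). The boxicity $\mathrm{box}(H)$ of a finite simple graph $H$ is the minimum integer $d\ge 0$ such that there exist $d$ interval graphs $I_1,\dots,I_d$ on $V(H)$ with $E(H)=\bigcap_{j=1}^d E(I_j)$; the empty intersection ($d=0$) is the set of all pairs of vertices. *)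

theory Defs
  imports
    Complex_Main
    "HOL-Algebra.QuotRing"
    "HOL-Algebra.Ring_Divisibility"
    "Graph_Theory.Kuratowski"
begin

text \<open>
  A simple graph is represented as a symmetric, loop-free pair digraph: the edge
  \<open>{u, v}\<close> is the pair of arcs \<open>(u, v)\<close> and \<open>(v, u)\<close>.
\<close>

definition zero_divisors :: "('a, 'b) ring_scheme \<Rightarrow> 'a set" where
  "zero_divisors Q =
     {r \<in> carrier Q. \<exists>s \<in> carrier Q - {\<zero>\<^bsub>Q\<^esub>}. r \<otimes>\<^bsub>Q\<^esub> s = \<zero>\<^bsub>Q\<^esub>}"

definition zero_divisor_graph :: "('a, 'b) ring_scheme \<Rightarrow> 'a pair_pre_digraph" where
  "zero_divisor_graph Q =
     \<lparr> pverts = zero_divisors Q - {\<zero>\<^bsub>Q\<^esub>},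
       parcs = {(r, s). r \<in> zero_divisors Q - {\<zero>\<^bsub>Q\<^esub>} \<and> s \<in> zero_divisors Q - {\<zero>\<^bsub>Q\<^esub>} \<and>
                        r \<noteq> s \<and> r \<otimes>\<^bsub>Q\<^esub> s = \<zero>\<^bsub>Q\<^esub>} \<rparr>"

definition neighbourhood :: "'a pair_pre_digraph \<Rightarrow> 'a \<Rightarrow> 'a set" where
  "neighbourhood G v = {w. (v, w) \<in> parcs G}"

definition twin_rel :: "'a pair_pre_digraph \<Rightarrow> 'a rel" where
  "twin_rel G =
     {(u, v). u \<in> pverts G \<and> v \<in> pverts G \<and>
              neighbourhood G u - {u, v} = neighbourhood G v - {u, v}}"

definition twin_reduction :: "'a pair_pre_digraph \<Rightarrow> 'a set pair_pre_digraph" where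
  "twin_reduction G =
     \<lparr> pverts = pverts G // twin_rel G,
       parcs = {(twin_rel G `` {u}, twin_rel G `` {v}) | u v.
                  twin_rel G `` {u} \<noteq> twin_rel G `` {v} \<and> (u, v) \<in> parcs G} \<rparr>"

text \<open>The graph without vertices is not regarded as a clique.\<close>

definition clique_graph :: "'a pair_pre_digraph \<Rightarrow> bool" where
  "clique_graph G \<longleftrightarrow> (\<exists>n \<ge> 1. K\<^bsub>n\<^esub> (with_proj G))"

definition interval_graph :: "'a pair_pre_digraph \<Rightarrow> bool" where
  "interval_graph G \<longleftrightarrow>
     (\<exists>l r :: 'a \<Rightarrow> real.
        (\<forall>v \<in> pverts G. l v \<le> r v) \<and>
        parcs G = {(u, v). u \<in> pverts G \<and> v \<in> pverts G \<and> u \<noteq> v \<and>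
                           {l u..r u} \<inter> {l v..r v} \<noteq> {}})"

text \<open>
  The intersection of the edge sets is taken inside the set of all pairs of distinct
  vertices, so that for \<open>d = 0\<close> it is that whole set.
\<close>

definition has_box_representation :: "'a pair_pre_digraph \<Rightarrow> nat \<Rightarrow> bool" where
  "has_box_representation H d \<longleftrightarrow>
     (\<exists>I :: nat \<Rightarrow> 'a pair_pre_digraph.
        (\<forall>j < d. interval_graph (I j) \<and> pverts (I j) = pverts H) \<and>
        parcs H = {(u, v). u \<in> pverts H \<and> v \<in> pverts H \<and> u \<noteq> v \<and>
                           (\<forall>j < d. (u, v) \<in> parcs (I j))})"

definition boxicity :: "'a pair_pre_digraph \<Rightarrow> nat" where
  "boxicity H = (LEAST d. has_box_representation H d)"

lemma equiv_twin_rel: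
  assumes "pair_sym_digraph G"
  shows "equiv (pverts G) (twin_rel G)"
proof (rule equivI)
  have sym: "(v, u) \<in> parcs G" if "(u, v) \<in> parcs G" for u v
    using arcs_ends_symmetric[OF pair_sym_digraph.pair_sym_arcs[OF assms]] that by simp
  show "twin_rel G \<subseteq> pverts G \<times> pverts G" "refl_on (pverts G) (twin_rel G)"
    "Relation.sym (twin_rel G)"
    by (auto simp: twin_rel_def refl_on_def intro!: symI)
  show "trans (twin_rel G)"
  proof (rule transI)
    fix u v w assume "(u, v) \<in> twin_rel G" "(v, w) \<in> twin_rel G"
    then have V: "u \<in> pverts G" "w \<in> pverts G"
      and uv: "\<And>x. x \<noteq> u \<Longrightarrow> x \<noteq> v \<Longrightarrow> (u, x) \<in> parcs G \<longleftrightarrow> (v, x) \<in> parcs G"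
      and vw: "\<And>x. x \<noteq> v \<Longrightarrow> x \<noteq> w \<Longrightarrow> (v, x) \<in> parcs G \<longleftrightarrow> (w, x) \<in> parcs G"
      by (auto simp: twin_rel_def neighbourhood_def set_eq_iff)
    have "(u, x) \<in> parcs G \<longleftrightarrow> (w, x) \<in> parcs G" if "x \<noteq> u" "x \<noteq> w" for x
      using that uv vw sym by metis
    then show "(u, w) \<in> twin_rel G"
      using V by (auto simp: twin_rel_def neighbourhood_def)
  qed
qed

text \<open>The minimum defining the boxicity of a finite simple graph is attained.\<close>

lemma has_box_representation_exists:
  assumes "pair_graph H"
  shows "\<exists>d. has_box_representation H d"
proof -
  interpret pair_graph H by fact
  define V where "V = pverts H"
  define N where "N = {(x, y). x \<in> V \<and> y \<in> V \<and> x \<noteq> y \<and> (x, y) \<notin> parcs H}"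
  have "finite N"
    by (rule finite_subset[of _ "V \<times> V"]) (auto simp: N_def V_def)
  then obtain f d where f: "f ` {..<d::nat} = N"
    using finite_imp_nat_seg_image_inj_on[of N] by (auto simp: lessThan_def)
  define I where "I j = \<lparr> pverts = V, parcs = {(u, v). u \<in> V \<and> v \<in> V \<and> u \<noteq> v \<and>
      (u, v) \<noteq> f j \<and> (v, u) \<noteq> f j} \<rparr>" for j
  have iv: "interval_graph (I j)" if "j < d" for j
  proof -
    obtain x y where xy: "f j = (x, y)" by (cases "f j")
    have "f j \<in> N" using f that by auto
    then have "x \<noteq> y" using xy by (auto simp: N_def)
    then show ?thesis unfolding interval_graph_def I_def xy
      by (intro exI[of _ "\<lambda>v. if v = y then 1 else 0"] exI[of _ "\<lambda>v. if v = x then 0 else 1"])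
        auto
  qed
  have sym: "(v, u) \<in> parcs H" if "(u, v) \<in> parcs H" for u v
    using arcs_ends_symmetric[OF pair_sym_arcs] that by simp
  have nadj: "f j \<notin> parcs H" "prod.swap (f j) \<notin> parcs H" if "j < d" for j
  proof -
    have "f j \<in> N" using f that by auto
    then show "f j \<notin> parcs H" "prod.swap (f j) \<notin> parcs H"
      using sym by (auto simp: N_def)
  qed
  have "parcs H = {(u, v). u \<in> V \<and> v \<in> V \<and> u \<noteq> v \<and> (\<forall>j < d. (u, v) \<in> parcs (I j))}"
    (is "_ = ?R")
  proof (intro equalityI subsetI)
    fix e assume e: "e \<in> parcs H"
    obtain u v where uv: "e = (u, v)" by (cases e)
    have "u \<in> V" "v \<in> V" "u \<noteq> v"
      using e uv wellformed' pair_no_loops[of e] by (auto simp: V_def)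
    moreover have "(u, v) \<noteq> f j" "(v, u) \<noteq> f j" if "j < d" for j
      using nadj[OF that] e uv by (metis, metis swap_simp)
    ultimately show "e \<in> ?R" by (auto simp: uv I_def)
  next
    fix e assume e: "e \<in> ?R"
    show "e \<in> parcs H"
    proof (rule ccontr)
      assume "e \<notin> parcs H"
      then have "e \<in> N" using e by (auto simp: N_def)
      then obtain j where "j < d" "e = f j" using f by auto
      then show False using e by (auto simp: I_def)
    qed
  qed
  then have "has_box_representation H d"
    unfolding has_box_representation_def V_def[symmetric]
    using iv by (intro exI[of _ I]) (auto simp: I_def)
  then show ?thesis ..
qed

end

theory Submission
  imports Defs
begin

text \<open>
  Modulo the intersection \<open>I\<close> of two incomparable prime ideals \<open>P\<close> and \<open>P'\<close>, the nonzero zero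
  divisors are the residues of \<open>P - P'\<close> and those of \<open>P' - P\<close>, and two of them annihilate each
  other exactly if they lie on different sides. So the zero divisor graph is complete bipartite
  with nonempty sides. Two vertices on the same side are twins, hence two different twin classes
  (there may be only one) have adjacent representatives.
\<close>

section \<open>Twin reduction of complete bipartite graphs, and boxicity of cliques\<close>

lemma clique_graph_twin_reduction_complete_bipartite:
  assumes K: "K\<^bsub>m,n\<^esub> (with_proj G)" and "m \<ge> 1"
  shows "clique_graph (twin_reduction G)"
proof -
  interpret pair_graph G
    using K by (rule pair_graphI_complete_bipartite)
  obtain U V where UV: "pverts G = U \<union> V" "U \<inter> V = {}" "card U = m"
      and arcs: "parcs G = U \<times> V \<union> V \<times> U"
    using K unfolding complete_bipartite_digraph_pair_def by auto
  let ?T = "twin_rel G" and ?H = "twin_reduction G"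
  have equiv: "equiv (pverts G) ?T"
    by (rule equiv_twin_rel) unfold_locales
  have arc: "(x, y) \<in> parcs G"
    if "x \<in> pverts G" "y \<in> pverts G" "?T `` {x} \<noteq> ?T `` {y}" for x y
  proof (rule ccontr)
    assume "(x, y) \<notin> parcs G"
    then have "x \<in> U \<and> y \<in> U \<or> x \<in> V \<and> y \<in> V"
      using that UV(1) arcs by auto
    \<comment> \<open>On a common side the whole neighbourhoods agree, both being the opposite side;
      this is stronger than being twins.\<close>
    then have "neighbourhood G x = neighbourhood G y"
      using UV(2) arcs by (auto simp: neighbourhood_def)
    then have "(x, y) \<in> ?T"
      using that by (simp add: twin_rel_def)
    then show False
      using that(3) equiv_class_eq[OF equiv] by blast
  qed
  have "parcs ?H = {(X, Y). (X, Y) \<in> pverts ?H \<times> pverts ?H \<and> X \<noteq> Y}"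
  proof (intro equalityI subsetI)
    fix e assume "e \<in> parcs ?H"
    then show "e \<in> {(X, Y). (X, Y) \<in> pverts ?H \<times> pverts ?H \<and> X \<noteq> Y}"
      using in_arcsD1 in_arcsD2 by (auto simp: twin_reduction_def intro!: quotientI)
  next
    fix e assume "e \<in> {(X, Y). (X, Y) \<in> pverts ?H \<times> pverts ?H \<and> X \<noteq> Y}"
    then obtain x y where "e = (?T `` {x}, ?T `` {y})" "?T `` {x} \<noteq> ?T `` {y}"
        "x \<in> pverts G" "y \<in> pverts G"
      by (auto simp: twin_reduction_def elim!: quotientE)
    then show "e \<in> parcs ?H"
      using arc[of x y] unfolding twin_reduction_def by auto
  qed
  moreover have fin: "finite (pverts ?H)"
    using pair_finite_verts by (simp add: twin_reduction_def quotient_def)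
  \<comment> \<open>\<open>m \<ge> 1\<close> enters here: a clique must have a vertex.\<close>
  moreover have "pverts ?H \<noteq> {}"
    using UV(1,3) \<open>m \<ge> 1\<close> by (auto simp: twin_reduction_def quotient_def)
  then have "card (pverts ?H) \<ge> 1"
    using fin by (simp add: Suc_le_eq card_gt_0_iff)
  ultimately show ?thesis
    unfolding clique_graph_def complete_digraph_pair_def by blast
qed

text \<open>For \<open>d = 0\<close> the intersection of edge sets consists of all pairs of distinct
  vertices, which is the edge set of a complete graph.\<close>

lemma boxicity_clique_graph:
  assumes "clique_graph H"
  shows "boxicity H = 0"
proof -
  have "has_box_representation H 0"
    using assms
    by (auto simp: clique_graph_def complete_digraph_pair_def has_box_representation_def)
  then show ?thesis
    unfolding boxicity_def by (intro Least_eq_0)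
qed

section \<open>The zero divisor graph modulo an intersection of two primes\<close>

lemma (in ideal) coset_eq_iff_mem:
  assumes "x \<in> carrier R"
  shows "I +> x = I \<longleftrightarrow> x \<in> I"
  using a_rcos_const rcos_const_imp_mem[OF assms] by auto

text \<open>Everything rests on \<open>mult_zero\<close>: by primality, a product of residues
  vanishes iff each of \<open>P\<close> and \<open>P'\<close> contains at least one of the factors.
  Incomparability of the primes makes both sides nonempty.\<close>

lemma (in cring) zero_divisor_graph_quot_Int_primeideals:
  assumes "primeideal P R" "primeideal P' R" "\<not> P \<subseteq> P'" "\<not> P' \<subseteq> P"
  defines "I \<equiv> P \<inter> P'"
  defines "U \<equiv> (+>) I ` (P - P')" and "V \<equiv> (+>) I ` (P' - P)"
  shows "U \<inter> V = {}" and "U \<noteq> {}" and "V \<noteq> {}"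
    and "zero_divisor_graph (R Quot I) = \<lparr> pverts = U \<union> V, parcs = U \<times> V \<union> V \<times> U \<rparr>"
proof -
  interpret P: primeideal P R by fact
  interpret P': primeideal P' R by fact
  interpret I: ideal I R
    unfolding I_def by (intro i_intersect P.is_ideal P'.is_ideal)
  let ?Q = "R Quot I"
  have car: "carrier ?Q = (+>) I ` carrier R"
    by (auto simp: FactRing_def A_RCOSETS_def')
  have zero: "\<zero>\<^bsub>?Q\<^esub> = I"
    by (simp add: FactRing_def)
  have mult: "(I +> x) \<otimes>\<^bsub>?Q\<^esub> (I +> y) = I +> x \<otimes> y"
    if "x \<in> carrier R" "y \<in> carrier R" for x y
    using that by (simp add: FactRing_def I.rcoset_mult_add)
  have mult_zero: "(I +> x) \<otimes>\<^bsub>?Q\<^esub> (I +> y) = I \<longleftrightarrow> (x \<in> P \<or> y \<in> P) \<and> (x \<in> P' \<or> y \<in> P')"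
    if "x \<in> carrier R" "y \<in> carrier R" for x y
  proof -
    have "x \<otimes> y \<in> P \<longleftrightarrow> x \<in> P \<or> y \<in> P"
      using that P.I_prime P.I_l_closed P.I_r_closed by blast
    moreover have "x \<otimes> y \<in> P' \<longleftrightarrow> x \<in> P' \<or> y \<in> P'"
      using that P'.I_prime P'.I_l_closed P'.I_r_closed by blast
    ultimately show ?thesis
      using that by (simp add: mult I.coset_eq_iff_mem) (auto simp: I_def)
  qed
  obtain a b where a: "a \<in> P" "a \<notin> P'" and b: "b \<in> P'" "b \<notin> P"
    using assms(3,4) by blast
  then show "U \<noteq> {}" "V \<noteq> {}"
    by (auto simp: U_def V_def)
  show disj: "U \<inter> V = {}"
  proof (rule ccontr)
    assume "U \<inter> V \<noteq> {}"
    then obtain x y where xy: "x \<in> P" "x \<notin> P'" "y \<in> P'" "y \<notin> P" "I +> x = I +> y"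
      by (auto simp: U_def V_def)
    \<comment> \<open>Since the cosets coincide, this square is the product of \<open>I +> x\<close>
      and \<open>I +> y\<close>, which is zero. But \<open>x\<close> is not in \<open>P'\<close>, so
      the square cannot vanish.\<close>
    then have "(I +> x) \<otimes>\<^bsub>?Q\<^esub> (I +> x) = I"
      using mult_zero[of x y] P.Icarr P'.Icarr by simp
    then show False
      using mult_zero[of x x] xy P.Icarr by simp
  qed
  have verts: "zero_divisors ?Q - {\<zero>\<^bsub>?Q\<^esub>} = U \<union> V"
  proof (intro equalityI subsetI)
    fix r assume "r \<in> zero_divisors ?Q - {\<zero>\<^bsub>?Q\<^esub>}"
    then obtain x y where xy: "x \<in> carrier R" "y \<in> carrier R" "r = I +> x"
        "I +> x \<noteq> I" "I +> y \<noteq> I" "(I +> x) \<otimes>\<^bsub>?Q\<^esub> (I +> y) = I"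
      unfolding zero_divisors_def car zero by auto
    \<comment> \<open>Neither \<open>x\<close> nor \<open>y\<close> lies in both primes, so each
      prime contains exactly one of them.\<close>
    then show "r \<in> U \<union> V"
      by (auto simp: mult_zero I.coset_eq_iff_mem U_def V_def) (auto simp: I_def)
  next
    fix r assume "r \<in> U \<union> V"
    \<comment> \<open>The annihilator \<open>y\<close> comes from the opposite side: it can be
      \<open>b\<close> for \<open>r\<close> in \<open>U\<close> and \<open>a\<close> for
      \<open>r\<close> in \<open>V\<close>.\<close>
    then obtain x y where x: "r = I +> x" and xy: "x \<in> P \<and> x \<notin> P' \<and> y \<in> P' \<and> y \<notin> P \<or>
        x \<in> P' \<and> x \<notin> P \<and> y \<in> P \<and> y \<notin> P'"
      using a b unfolding U_def V_def by blast
    then have "x \<in> carrier R" "y \<in> carrier R" "x \<notin> I" "y \<notin> I"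
      using P.Icarr P'.Icarr by (auto simp: I_def)
    moreover from this have "(I +> x) \<otimes>\<^bsub>?Q\<^esub> (I +> y) = I"
      using xy mult_zero by auto
    ultimately show "r \<in> zero_divisors ?Q - {\<zero>\<^bsub>?Q\<^esub>}"
      unfolding zero_divisors_def car zero x
      using I.coset_eq_iff_mem[of x] I.coset_eq_iff_mem[of y] by blast
  qed
  have "r \<noteq> s \<and> r \<otimes>\<^bsub>?Q\<^esub> s = I \<longleftrightarrow> (r, s) \<in> U \<times> V \<union> V \<times> U"
    if rs: "r \<in> U \<union> V" "s \<in> U \<union> V" for r s
  proof -
    have UU: "r \<otimes>\<^bsub>?Q\<^esub> s \<noteq> I" if "r \<in> U" "s \<in> U"
      using that P.Icarr by (auto simp: U_def mult_zero)
    have VV: "r \<otimes>\<^bsub>?Q\<^esub> s \<noteq> I" if "r \<in> V" "s \<in> V"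
      using that P'.Icarr by (auto simp: V_def mult_zero)
    have UV: "r \<otimes>\<^bsub>?Q\<^esub> s = I" if rs: "r \<in> U \<and> s \<in> V \<or> r \<in> V \<and> s \<in> U"
    proof -
      obtain x y where xy: "r = I +> x" "s = I +> y" "x \<in> P \<and> y \<in> P' \<or> x \<in> P' \<and> y \<in> P"
        using rs unfolding U_def V_def by blast
      then show ?thesis
        using P.Icarr P'.Icarr mult_zero[of x y] by blast
    qed
    \<comment> \<open>From right to left, \<open>r \<noteq> s\<close> follows from the disjointness
      of the sides.\<close>
    show ?thesis
      using rs UU VV UV disj by blast
  qed
  then have arcs: "{(r, s). r \<in> U \<union> V \<and> s \<in> U \<union> V \<and> r \<noteq> s \<and> r \<otimes>\<^bsub>?Q\<^esub> s = I}
      = U \<times> V \<union> V \<times> U"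
    by blast
  show "zero_divisor_graph ?Q = \<lparr> pverts = U \<union> V, parcs = U \<times> V \<union> V \<times> U \<rparr>"
    unfolding zero_divisor_graph_def verts unfolding zero arcs ..
qed

section \<open>Principal ideals generated by prime elements\<close>

lemma (in cring) mem_cgenideal_iff:
  assumes "p \<in> carrier R" "x \<in> carrier R"
  shows "x \<in> PIdl p \<longleftrightarrow> p divides x"
  using assms by (auto simp: cgenideal_def factor_def m_comm)

text \<open>Write \<open>q = p \<otimes> c\<close>. The prime \<open>q\<close> divides
  \<open>p\<close>, as desired, or it divides \<open>c\<close>; in the latter case cancelling
  \<open>q\<close> would make \<open>p\<close> a unit.\<close>

lemma (in domain) ring_prime_divides_imp_associated:
  assumes "p \<in> carrier R" "q \<in> carrier R" "ring_prime p" "ring_prime q" "p divides q"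
  shows "p \<sim> q"
proof -
  obtain c where c: "c \<in> carrier R" "q = p \<otimes> c"
    using assms(5) by (auto simp: factor_def)
  have "q divides p \<otimes> c"
    using c assms(2) by (auto simp: factor_def intro!: bexI[of _ \<one>])
  then consider "q divides p" | "q divides c"
    using primeE[OF ring_primeE(3)[OF assms(2,4)]] assms(1) c(1) by metis
  then show ?thesis
  proof cases
    case 1
    then show ?thesis
      using assms(5) by (simp add: associated_def)
  next
    case 2
    then obtain d where d: "d \<in> carrier R" "c = q \<otimes> d"
      by (auto simp: factor_def)
    have "p \<otimes> (q \<otimes> d) = q"
      using c(2) d(2) by simp
    then have "q \<otimes> \<one> = q \<otimes> (p \<otimes> d)"
      using m_lcomm[OF assms(2,1) d(1)] r_one[OF assms(2)] by metis
    then have "\<one> = p \<otimes> d"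
      using m_lcancel[OF ring_primeE(1)[OF assms(2,4)] assms(2)] assms(1) d(1) by blast
    then have "p divides \<one>"
      using d(1) by (auto simp: factor_def)
    then show ?thesis
      using divides_one[OF assms(1)] ring_primeE(3)[OF assms(1,3)] by (auto simp: prime_def)
  qed
qed

text \<open>The inclusion from right to left is the substantial one: if \<open>q\<close> divides
  \<open>r \<otimes> p\<close>, then it divides \<open>r\<close>, because it is prime and does not
  divide the non-associated prime \<open>p\<close>.\<close>

lemma (in domain) cgenideal_mult_primes:
  assumes p: "p \<in> carrier R" "ring_prime p" and q: "q \<in> carrier R" "ring_prime q"
    and "\<not> p \<sim> q"
  shows "PIdl (p \<otimes> q) = PIdl p \<inter> PIdl q"
proof (intro equalityI subsetI)
  fix x assume "x \<in> PIdl (p \<otimes> q)"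
  then obtain r where r: "r \<in> carrier R" "x = r \<otimes> (p \<otimes> q)"
    by (auto simp: cgenideal_def)
  then have "x = (r \<otimes> q) \<otimes> p" "x = (r \<otimes> p) \<otimes> q"
    using p(1) q(1) by (simp_all add: m_ac)
  moreover have "r \<otimes> q \<in> carrier R" "r \<otimes> p \<in> carrier R"
    using r(1) p(1) q(1) by simp_all
  ultimately show "x \<in> PIdl p \<inter> PIdl q"
    unfolding cgenideal_def by blast
next
  fix x assume x: "x \<in> PIdl p \<inter> PIdl q"
  then obtain r where r: "r \<in> carrier R" "x = r \<otimes> p"
    by (auto simp: cgenideal_def)
  have "q divides r \<otimes> p"
    using x r p(1) q(1) mem_cgenideal_iff[of q x] by simp
  moreover have "\<not> q divides p"
    using ring_prime_divides_imp_associated[OF q(1) p(1) q(2) p(2)] assms(5)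
    by (auto simp: associated_def)
  ultimately have "q divides r"
    using primeE[OF ring_primeE(3)[OF q]] r(1) p(1) by metis
  then obtain s where "s \<in> carrier R" "r = q \<otimes> s"
    by (auto simp: factor_def)
  then show "x \<in> PIdl (p \<otimes> q)"
    using r(2) p(1) q(1) by (auto simp: cgenideal_def m_ac intro!: exI[of _ s])
qed

theorem corollary75:
  fixes R :: "('a, 'b) ring_scheme" (structure)
    and I :: "'a set" and g u p\<^sub>1 p\<^sub>2 :: 'a
  assumes "principal_domain R"
    and "g \<in> carrier R" and "I = PIdl g"
    and "I \<noteq> carrier R" and "\<not> primeideal I R"
    and "finite (carrier (R Quot I))"
    and "u \<in> Units R"
    and "p\<^sub>1 \<in> carrier R" and "p\<^sub>2 \<in> carrier R"
    and "ring_prime p\<^sub>1" and "ring_prime p\<^sub>2" and "\<not> p\<^sub>1 \<sim> p\<^sub>2"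
    and "g = u \<otimes> (p\<^sub>1 \<otimes> p\<^sub>2)"
  shows "clique_graph (twin_reduction (zero_divisor_graph (R Quot I))) \<and>
         boxicity (twin_reduction (zero_divisor_graph (R Quot I))) = 0"
proof -
  interpret principal_domain R by fact
  let ?G = "zero_divisor_graph (R Quot I)"
  \<comment> \<open>The unit \<open>u\<close> is absorbed here, as associated elements generate the
    same ideal.\<close>
  have "g \<sim> p\<^sub>1 \<otimes> p\<^sub>2"
    using ring_associated_iff[of g "p\<^sub>1 \<otimes> p\<^sub>2"] assms by auto
  then have "I = PIdl (p\<^sub>1 \<otimes> p\<^sub>2)"
    using associated_iff_same_ideal[of g "p\<^sub>1 \<otimes> p\<^sub>2"] assms by simp
  then have I: "I = PIdl p\<^sub>1 \<inter> PIdl p\<^sub>2"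
    using cgenideal_mult_primes assms(8-12) by simp
  have prime: "primeideal (PIdl p\<^sub>1) R" "primeideal (PIdl p\<^sub>2) R"
    using primeideal_iff_prime assms(8-11) ring_primeE(1) by auto
  have "\<not> p\<^sub>1 divides p\<^sub>2" "\<not> p\<^sub>2 divides p\<^sub>1"
    using ring_prime_divides_imp_associated[of p\<^sub>1 p\<^sub>2] ring_prime_divides_imp_associated[of p\<^sub>2 p\<^sub>1]
      assms(8-12) by (auto simp: associated_def)
  then have incomparable: "\<not> PIdl p\<^sub>1 \<subseteq> PIdl p\<^sub>2" "\<not> PIdl p\<^sub>2 \<subseteq> PIdl p\<^sub>1"
    using to_contain_is_to_divide assms(8,9) by auto
  obtain U V where UV: "U \<inter> V = {}" "U \<noteq> {}"
      and G: "?G = \<lparr> pverts = U \<union> V, parcs = U \<times> V \<union> V \<times> U \<rparr>"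
    using zero_divisor_graph_quot_Int_primeideals[OF prime incomparable] unfolding I by blast
  have "pverts ?G \<subseteq> carrier (R Quot I)"
    by (auto simp: zero_divisor_graph_def zero_divisors_def)
  then have fin: "finite (pverts ?G)"
    using assms(6) finite_subset by blast
  then have "K\<^bsub>card U,card V\<^esub> (with_proj ?G)"
    unfolding complete_bipartite_digraph_pair_def using UV(1) G by auto
  moreover have "card U \<ge> 1"
    using fin UV(2) G by (simp add: Suc_le_eq card_gt_0_iff)
  ultimately have "clique_graph (twin_reduction ?G)"
    by (rule clique_graph_twin_reduction_complete_bipartite)
  then show ?thesis
    using boxicity_clique_graph by blast
qed

end
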